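(* Let $D\ge 2$ and $d\ge D-1$ be integers and let $\bm{\Sigma}\in\mathbb{R}^{(D-1)\times(D-1)}$ be symmetric positive definite. For $i\in\{1,\dots,D\}$ let $$\bm{\mu}_i = \bm{A}^{-1}\bm{B}\operatorname{vec}(\bm{\Sigma}) - \bm{\Sigma}\bm{a}_{i-1} - \sum_{j=1}^{i-2}\frac{1}{j+1}\bm{\Sigma}\bm{a}_j\in\mathbb{R}^{D-1},$$ let $\bm{m}_i\in\mathbb{R}^d$ be the concatenation of $\bm{\mu}_i$ and the $(d-D+1)$-dimensional zero vector, and let $\bm{C}=\begin{bmatrix}\bm{\Sigma} & \bm{0}\\ \bm{0} & \bm{I}_{d-D+1}\end{bmatrix}\in\mathbb{R}^{d\times d}$. Let $\mathcal{X},\mathcal{Z}\subset\mathbb{R}^d$ be open sets, let $g:\mathcal{Z}\to\mathcal{X}$ be a diffeomorphism, and let $\bm{x}$ be a random vector in $\mathcal{X}$ such that $g^{-1}(\bm{x})\mid C_i\sim\mathcal{N}(\bm{m}_i,\bm{C})$ for every class $C_i$, $i\in\{1,\dots,D\}$. Let $f_{\mathcal{X}_i}$ denote the probability density function of $\bm{x}$ given $C_i$. Then the first $D-1$ coordinates of $\bm{z}=g^{-1}(\bm{x})$ form the isometric-log-ratio transformed likelihood function of $\bm{x}$: for every $\bm{x}\in\mathcal{X}$, with $\bm{z}=[z_1,\dots,z_d]^T=g^{-1}(\bm{x})$, $$[z_1,\dots,z_{D-1}]^T = \operatorname{ilr}\big([f_{\mathcal{X}_1}(\bm{x}),\dots,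f_{\mathcal{X}_D}(\bm{x})]^T\big).$$
   Context: Isometric-log-ratio transformation: for $\bm{p}=[p_1,\dots,p_D]^T$ with all $p_j>0$, $\operatorname{ilr}(\bm{p})\in\mathbb{R}^{D-1}$ is the vector whose $i$th component, $1\le i\le D-1$, is $$\frac{1}{\sqrt{i(i+1)}}\log\left(\frac{\prod_{j=1}^{i}p_j}{(p_{i+1})^{i}}\right).$$ The class-conditional densities of $\bm{x}$ are the ones given by the change of variable formula from the density $f_{\mathcal{Z}_i}$ of $\mathcal{N}(\bm{m}_i,\bm{C})$: $f_{\mathcal{X}_i}(\bm{x})=f_{\mathcal{Z}_i}(\bm{z})\left|\det\left(\frac{\partial\bm{x}}{\partial\bm{z}}\right)\right|^{-1}$ with $\bm{z}=g^{-1}(\bm{x})$, where $\frac{\partial\bm{x}}{\partial\bm{z}}$ is the Jacobian matrix of $g$ at $\bm{z}$. For $i\in\{1,\dots,D-1\}$, $\bm{a}_i=\sqrt{\frac{i+1}{i}}\,\bm{e}_i$, where $\bm{e}_i$ is the $i$th vector of the standard basis of $\mathbb{R}^{D-1}$, and $\bm{a}_0=\bm{0}$. Empty sums are zero. $\operatorname{vec}(\bm{\Sigma})\in\mathbb{R}^{(D-1)^2}$ is the (column-stacking) vectorization of $\bm{\Sigma}$. $\bm{I}_K$ is the $K\times K$ identity matrix. $\bm{A}=(\alpha_{ij})_{1\le i,j\le D-1}$ is the (lower triangular, invertible) real matrix with $\alpha_{ij}=2\sqrt{\frac{i+1}{i}}$ if $i=j$, $\alpha_{ij}=\frac{2}{\sqrt{j(j+1)}}$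 if $j<i$, and $\alpha_{ij}=0$ otherwise. $\bm{B}=[\bm{B}^{(1)}\ \bm{B}^{(2)}\ \cdots\ \bm{B}^{(D-1)}]$ is the real $(D-1)\times(D-1)^2$ block matrix whose $b$th block $\bm{B}^{(b)}=(\beta^{(b)}_{ij})_{1\le i,j\le D-1}$ is given by: $\beta^{(b)}_{ij}=\frac{b+1}{b}$ if $i=j=b$; $\beta^{(b)}_{ij}=2\sqrt{\frac{i+1}{i\,b(b+1)}}$ if $i=j$ and $b<i$; $\beta^{(b)}_{ij}=\frac{1}{\sqrt{j\,b\,(j+1)(b+1)}}$ if $b<i$ and $j<i$; and $\beta^{(b)}_{ij}=0$ otherwise. *)

theory Defs
  imports "HOL-Probability.Probability" "Jordan_Normal_Form.Gauss_Jordan_Elimination"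
    "Jordan_Normal_Form.Determinant"
begin

unbundle no vec_syntax

text \<open>
  Vectors and matrices whose size depends on a natural number are those of
  \<^theory>\<open>Jordan_Normal_Form.Matrix\<close>, with indices starting at 0: the component with
  mathematical index \<open>i\<close> sits at position \<open>i - 1\<close>. Functions that take a mathematical index
  as an argument (such as \<open>beta b i j\<close> or \<open>mu n S i\<close>) keep the 1-based numbering.
  Everywhere \<open>n\<close> stands for \<open>D - 1\<close>.

  The space on which calculus and measure theory take place is \<open>real ^ 'd\<close>; an
  enumeration \<open>ix\<close> of the index type by \<open>{..<CARD('d)}\<close> fixes the order of the coordinates.
\<close>

definition coords :: "(nat \<Rightarrow> 'd::finite) \<Rightarrow> real ^ 'd \<Rightarrow> real Matrix.vec" where
  "coords ix z = Matrix.vec CARD('d) (\<lambda>k. vec_nth z (ix k))"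

definition ilr :: "real Matrix.vec \<Rightarrow> real Matrix.vec" where
  "ilr p = Matrix.vec (dim_vec p - 1) (\<lambda>k. let i = k + 1 in
     1 / sqrt (real i * (real i + 1)) * ln ((\<Prod>j = 1..i. p $ (j - 1)) / (p $ i) ^ i))"

definition pos_def_mat :: "nat \<Rightarrow> real Matrix.mat \<Rightarrow> bool" where
  "pos_def_mat n S \<longleftrightarrow> S \<in> carrier_mat n n \<and> transpose_mat S = S \<and>
     (\<forall>v \<in> carrier_vec n. v \<noteq> 0\<^sub>v n \<longrightarrow> scalar_prod v (S *\<^sub>v v) > 0)"

definition alpha :: "nat \<Rightarrow> nat \<Rightarrow> real" where
  "alpha i j =
     (if i = j then 2 * sqrt ((real i + 1) / real i)
      else if j < i then 2 / sqrt (real j * (real j + 1))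
      else 0)"

definition A_mat :: "nat \<Rightarrow> real Matrix.mat" where
  "A_mat n = Matrix.mat n n (\<lambda>(r, c). alpha (r + 1) (c + 1))"

definition beta :: "nat \<Rightarrow> nat \<Rightarrow> nat \<Rightarrow> real" where
  "beta b i j =
     (if i = j \<and> j = b then (real b + 1) / real b
      else if i = j \<and> b < i then 2 * sqrt ((real i + 1) / (real i * real b * (real b + 1)))
      else if b < i \<and> j < i
        then 1 / sqrt (real j * real b * (real j + 1) * (real b + 1))
      else 0)"

text \<open>Column \<open>c\<close> of \<open>B\<close> is column \<open>c mod n\<close> of its block number \<open>c div n\<close>
  (both counted from 0).\<close>

definition B_mat :: "nat \<Rightarrow> real Matrix.mat" where
  "B_mat n = Matrix.mat n (n * n) (\<lambda>(r, c). beta (c div n + 1) (r + 1) (c mod n + 1))"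

text \<open>Column-stacking vectorization.\<close>

definition vectorize :: "real Matrix.mat \<Rightarrow> real Matrix.vec" where
  "vectorize S = Matrix.vec (dim_row S * dim_col S)
     (\<lambda>k. S $$ (k mod dim_row S, k div dim_row S))"

definition a_vec :: "nat \<Rightarrow> nat \<Rightarrow> real Matrix.vec" where
  "a_vec n i =
     (if i = 0 then 0\<^sub>v n else sqrt ((real i + 1) / real i) \<cdot>\<^sub>v unit_vec n (i - 1))"

text \<open>For \<open>i = 1\<close> the truncated difference \<open>i - 2\<close> is 0, so the sum is empty as intended.\<close>

definition mu :: "nat \<Rightarrow> real Matrix.mat \<Rightarrow> nat \<Rightarrow> real Matrix.vec" where
  "mu n S i =
     the (mat_inverse (A_mat n)) *\<^sub>v (B_mat n *\<^sub>v vectorize S)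
       - S *\<^sub>v a_vec n (i - 1)
       - finsum_vec TYPE(real) n (\<lambda>j. (1 / (real j + 1)) \<cdot>\<^sub>v (S *\<^sub>v a_vec n j)) {1..i - 2}"

definition class_mean :: "nat \<Rightarrow> nat \<Rightarrow> real Matrix.mat \<Rightarrow> nat \<Rightarrow> real Matrix.vec" where
  "class_mean n d S i = mu n S i @\<^sub>v 0\<^sub>v (d - n)"

definition class_cov :: "nat \<Rightarrow> nat \<Rightarrow> real Matrix.mat \<Rightarrow> real Matrix.mat" where
  "class_cov n d S = four_block_mat S (0\<^sub>m n (d - n)) (0\<^sub>m (d - n) n) (1\<^sub>m (d - n))"

definition mvn_density :: "real Matrix.vec \<Rightarrow> real Matrix.mat \<Rightarrow> real Matrix.vec \<Rightarrow> real" where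
  "mvn_density m K z =
     exp (- (scalar_prod (z - m) (the (mat_inverse K) *\<^sub>v (z - m))) / 2) /
       sqrt ((2 * pi) ^ dim_vec m * Determinant.det K)"

text \<open>Diffeomorphisms are taken in the \<open>C\<^sup>1\<close> sense, the weakest one for which the
  change of variable formula is customarily stated.\<close>

definition C1_on :: "(real ^ 'd::finite) set \<Rightarrow> (real ^ 'd \<Rightarrow> real ^ 'd) \<Rightarrow> bool" where
  "C1_on U f \<longleftrightarrow> (\<exists>f' :: real ^ 'd \<Rightarrow> ((real ^ 'd) \<Rightarrow>\<^sub>L (real ^ 'd)).
     (\<forall>x\<in>U. (f has_derivative blinfun_apply (f' x)) (at x)) \<and> continuous_on U f')"

definition diffeomorphism ::
  "(real ^ 'd::finite) set \<Rightarrow> (real ^ 'd) set \<Rightarrow> (real ^ 'd \<Rightarrow> real ^ 'd) \<Rightarrow> bool" where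
  "diffeomorphism Z X g \<longleftrightarrow> bij_betw g Z X \<and> C1_on Z g \<and> C1_on X (inv_into Z g)"

text \<open>The density of \<open>x = g z\<close> obtained from the density \<open>fz\<close> of \<open>z\<close> by the change of
  variable formula; \<open>matrix (frechet_derivative g (at z))\<close> is the Jacobian matrix of \<open>g\<close>
  at \<open>z\<close>.\<close>

definition change_of_variable_density ::
  "(real ^ 'd::finite) set \<Rightarrow> (real ^ 'd \<Rightarrow> real ^ 'd) \<Rightarrow> (real ^ 'd \<Rightarrow> real) \<Rightarrow> real ^ 'd \<Rightarrow> real"
  where
  "change_of_variable_density Z g fz x = (let z = inv_into Z g x in
     fz z * inverse \<bar>Determinants.det (matrix (frechet_derivative g (at z)))\<bar>)"

text \<open>Density of the class-conditional normal distribution of the latent vector \<open>z\<close>.\<close>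

definition latent_density ::
  "(nat \<Rightarrow> 'd::finite) \<Rightarrow> nat \<Rightarrow> real Matrix.mat \<Rightarrow> nat \<Rightarrow> real ^ 'd \<Rightarrow> real" where
  "latent_density ix n S i z =
     mvn_density (class_mean n CARD('d) S i) (class_cov n CARD('d) S) (coords ix z)"

definition class_density ::
  "(nat \<Rightarrow> 'd::finite) \<Rightarrow> (real ^ 'd) set \<Rightarrow> (real ^ 'd \<Rightarrow> real ^ 'd) \<Rightarrow> nat \<Rightarrow> real Matrix.mat
     \<Rightarrow> nat \<Rightarrow> real ^ 'd \<Rightarrow> real" where
  "class_density ix Z g n S i = change_of_variable_density Z g (latent_density ix n S i)"

end

(* Write mu_i = w - Sigma s_i with w = A^{-1} B vec(Sigma). Up to a factor common to all classes,
   the density of class i is exp (- (z - w)^T s_i - s_i^T Sigma s_i / 2), because the terms quadratic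
   in z do not depend on i; a common nonzero factor (including the Jacobian) cancels in the ilr.
   Since s_1 + ... + s_i - i s_{i+1} is -sqrt(i(i+1)) e_i, the ith ilr component is z_i - w_i plus
   a combination of the numbers q_j = s_j^T Sigma s_j. This constant equals w_i: by a telescoping sum,
   the vector of these constants solves A w = (q_2, ..., q_D), and B is built so that
   B vec(Sigma) = (q_2, ..., q_D). *)

theory Submission
  imports Defs
begin

subsection \<open>Invertible matrices\<close>

text \<open>\<open>mat_inverse\<close> returns an option; a nonzero determinant excludes
  \<open>None\<close>, so that \<open>the\<close> yields a true two-sided inverse.\<close>

lemma mat_inverse_det_nonzero:
  fixes A :: "'a::field Matrix.mat"
  assumes A: "A \<in> carrier_mat n n" and det: "Determinant.det A \<noteq> 0"
  shows "A * the (mat_inverse A) = 1\<^sub>m n" "the (mat_inverse A) * A = 1\<^sub>m n"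
    "the (mat_inverse A) \<in> carrier_mat n n"
proof -
  have "mat_inverse A \<noteq> None"
    \<comment> \<open>The argument \<open>()\<close> fills the extension field of the matrix ring
      record, so that both facts speak of the same \<open>Units\<close>.\<close>
    using mat_inverse(1)[OF A, of "()"] det_non_zero_imp_unit[OF A det, of "()"] by blast
  then obtain B where "mat_inverse A = Some B" by auto
  with mat_inverse(2)[OF A] show "A * the (mat_inverse A) = 1\<^sub>m n"
    "the (mat_inverse A) * A = 1\<^sub>m n" "the (mat_inverse A) \<in> carrier_mat n n" by auto
qed

lemma mat_inverse_mult_vec_eqI:
  fixes A :: "'a::field Matrix.mat"
  assumes A: "A \<in> carrier_mat n n" and det: "Determinant.det A \<noteq> 0"
    and v: "v \<in> carrier_vec n"
  shows "the (mat_inverse A) *\<^sub>v (A *\<^sub>v v) = v"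
  using mat_inverse_det_nonzero[OF A det] A v assoc_mult_mat_vec[of "the (mat_inverse A)" n n A n v]
  by simp

text \<open>In the terms involving \<open>u\<close>, the inverse \<open>P\<close> meets
  \<open>K\<close> and cancels. With \<open>v\<close> the same for all classes, the only term that
  still contains \<open>P\<close> is thus independent of the class.\<close>

lemma inverse_quadratic_form_shift:
  fixes K :: "real Matrix.mat"
  assumes K: "K \<in> carrier_mat n n" and sym: "transpose_mat K = K"
    and det: "Determinant.det K \<noteq> 0"
    and v: "v \<in> carrier_vec n" and u: "u \<in> carrier_vec n"
  defines "P \<equiv> the (mat_inverse K)"
  shows "scalar_prod (v + K *\<^sub>v u) (P *\<^sub>v (v + K *\<^sub>v u)) =
    scalar_prod v (P *\<^sub>v v) + 2 * scalar_prod v u + scalar_prod u (K *\<^sub>v u)"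
proof -
  note inv = mat_inverse_det_nonzero[OF K det, folded P_def]
  have Ku: "K *\<^sub>v u \<in> carrier_vec n" and Pv: "P *\<^sub>v v \<in> carrier_vec n"
    using K u inv(3) v by auto
  have "P *\<^sub>v (v + K *\<^sub>v u) = P *\<^sub>v v + u"
    using mult_add_distrib_mat_vec[OF inv(3) v Ku] mat_inverse_mult_vec_eqI[OF K det u]
    by (simp add: P_def)
  moreover have "K *\<^sub>v (P *\<^sub>v v) = v"
    using assoc_mult_mat_vec[OF K inv(3) v] inv(1) v by simp
  \<comment> \<open>Symmetry moves \<open>K\<close> to the other factor, where it cancels
    \<open>P\<close>.\<close>
  then have "scalar_prod (K *\<^sub>v u) (P *\<^sub>v v) = scalar_prod v u"
    using transpose_vec_mult_scalar[OF K u Pv] sym comm_scalar_prod[OF Ku Pv] comm_scalar_prod[OF v u]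
    by (metis comm_scalar_prod[OF u v])
  moreover have "scalar_prod (K *\<^sub>v u) u = scalar_prod u (K *\<^sub>v u)"
    by (rule comm_scalar_prod[OF Ku u])
  ultimately show ?thesis
    using v u Ku Pv
    by (simp add: add_scalar_prod_distrib[of _ n] scalar_prod_add_distrib[of _ n])
qed

lemma pos_def_mat_det_nonzero:
  assumes "pos_def_mat n S"
  shows "Determinant.det S \<noteq> 0"
proof
  have S: "S \<in> carrier_mat n n" using assms by (simp add: pos_def_mat_def)
  assume "Determinant.det S = 0"
  then obtain v where v: "v \<in> carrier_vec n" "v \<noteq> 0\<^sub>v n" "S *\<^sub>v v = 0\<^sub>v n"
    using det_0_iff_vec_prod_zero_field[OF S] by auto
  then show False using assms by (auto simp: pos_def_mat_def)
qed

lemma det_A_mat_nonzero: "Determinant.det (A_mat n) \<noteq> 0"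
proof -
  have "Determinant.det (A_mat n) = prod_list (diag_mat (A_mat n))"
    by (rule det_lower_triangular[of n]) (auto simp: A_mat_def alpha_def)
  also have "\<dots> \<noteq> 0"
    by (auto simp: A_mat_def alpha_def diag_mat_def prod_list_zero_iff)
  finally show ?thesis .
qed

subsection \<open>Class means and the quadratic form of the covariance\<close>

text \<open>\<open>offset_coeff i k\<close> is the coefficient on \<open>e\<^sub>k\<close> of
  \<open>s\<^sub>i = a\<^bsub>i-1\<^esub> + (\<Sum>j\<le>i-2. a\<^sub>j / (j + 1))\<close>, the vector for which
  \<open>\<mu>\<^sub>i = w - \<Sigma> s\<^sub>i\<close> with \<open>w\<close> independent of \<open>i\<close>.\<close>

definition offset_coeff :: "nat \<Rightarrow> nat \<Rightarrow> real" where
  "offset_coeff i k =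
     (if Suc k = i then sqrt ((real k + 1) / real k)
      else if Suc k < i then 1 / sqrt (real k * (real k + 1)) else 0)"

definition offset :: "nat \<Rightarrow> nat \<Rightarrow> real Matrix.vec" where
  "offset n i = Matrix.vec n (\<lambda>k. offset_coeff i (k + 1))"

definition mean_base :: "nat \<Rightarrow> real Matrix.mat \<Rightarrow> real Matrix.vec" where
  "mean_base n S = the (mat_inverse (A_mat n)) *\<^sub>v (B_mat n *\<^sub>v vectorize S)"

definition offset_form :: "nat \<Rightarrow> real Matrix.mat \<Rightarrow> nat \<Rightarrow> real" where
  "offset_form n S i = scalar_prod (offset n i) (S *\<^sub>v offset n i)"

lemma offset_carrier [simp]: "offset n i \<in> carrier_vec n"
  by (simp add: offset_def)

text \<open>Brings the two nonzero branches of \<open>offset_coeff\<close> to the common denominator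
  \<open>sqrt (k * (k + 1))\<close>. At \<open>k = 0\<close> both sides are 0, since division by 0
  gives 0.\<close>

lemma sqrt_Suc_div: "sqrt ((real k + 1) / real k) = (real k + 1) / sqrt (real k * (real k + 1))"
proof -
  have "sqrt (real k + 1) = (real k + 1) / sqrt (real k + 1)"
    by (simp add: real_div_sqrt)
  then have "sqrt (real k + 1) / sqrt (real k) = (real k + 1) / sqrt (real k + 1) / sqrt (real k)"
    by (rule arg_cong)
  then show ?thesis
    by (simp only: real_sqrt_divide real_sqrt_mult divide_divide_eq_left mult.commute)
qed

text \<open>With denominator \<open>sqrt (k * (k + 1))\<close>, the first nonzero summand, at
  \<open>j = k + 1\<close>, has numerator \<open>k + 1\<close>; each later one adds 1.\<close>

lemma sum_offset_coeff:
  assumes "k \<ge> 1"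
  shows "(\<Sum>j = 1..i. offset_coeff j k) =
    (if k < i then real i / sqrt (real k * (real k + 1)) else 0)"
proof (induction i)
  case 0
  then show ?case by simp
next
  case (Suc i)
  then show ?case using assms sqrt_Suc_div[of i]
    by (auto simp: offset_coeff_def add.commute simp flip: add_divide_distrib)
qed

text \<open>This is why the ilr isolates one coordinate: for \<open>k < i\<close> the two terms
  cancel, for \<open>k > i\<close> both vanish, and at \<open>k = i\<close> only the subtracted one
  remains.\<close>

lemma sum_offset_coeff_diff:
  assumes "k \<ge> 1"
  shows "(\<Sum>j = 1..i. offset_coeff j k) - real i * offset_coeff (i + 1) k =
    (if k = i then - sqrt (real i * (real i + 1)) else 0)"
proof -
  have "real i * sqrt ((real i + 1) / real i) = sqrt (real i * (real i + 1))"
    unfolding sqrt_Suc_div times_divide_eq_right by (rule real_div_sqrt) simp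
  then show ?thesis
    unfolding sum_offset_coeff[OF assms] by (auto simp: offset_coeff_def)
qed

lemma mult_a_vec_index:
  assumes "S \<in> carrier_mat n n" "j \<le> n" "r < n"
  shows "(S *\<^sub>v a_vec n j) $ r = (if j = 0 then 0 else sqrt ((real j + 1) / real j) * S $$ (r, j - 1))"
  using assms by (auto simp: a_vec_def mult_mat_vec_def)

lemma mult_offset_index:
  assumes S: "S \<in> carrier_mat n n" and i: "1 \<le> i" "i \<le> n + 1" and r: "r < n"
  shows "(S *\<^sub>v offset n i) $ r =
    (S *\<^sub>v a_vec n (i - 1)) $ r + (\<Sum>j = 1..i - 2. (S *\<^sub>v a_vec n j) $ r / (real j + 1))"
proof -
  have "(S *\<^sub>v offset n i) $ r = (\<Sum>k = 0..<n. S $$ (r, k) * offset_coeff i (k + 1))"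
    using S r by (simp add: mult_mat_vec_def scalar_prod_def offset_def)
  also have "\<dots> = (\<Sum>k = 1..n. S $$ (r, k - 1) * offset_coeff i k)"
    by (simp add: sum.atLeast1_atMost_eq atLeast0LessThan)
  also have "\<dots> = (\<Sum>k = 1..i - 1. S $$ (r, k - 1) * offset_coeff i k)"
    \<comment> \<open>The coefficients vanish from \<open>k = i\<close> on, and
      \<open>i - 1 \<le> n\<close>.\<close>
    using i by (intro sum.mono_neutral_right) (auto simp: offset_coeff_def)
  also have "\<dots> = (S *\<^sub>v a_vec n (i - 1)) $ r + (\<Sum>j = 1..i - 2. (S *\<^sub>v a_vec n j) $ r / (real j + 1))"
  proof (cases "i = 1")
    case True
    then show ?thesis using mult_a_vec_index[OF S _ r] by simp
  next
    case False
    \<comment> \<open>This makes the truncated differences exact: indices up to \<open>m\<close>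
      form the weighted sum, and the last index \<open>Suc m\<close> carries the vector
      \<open>a_vec n (i - 1)\<close>.\<close>
    then obtain m where m: "i = Suc (Suc m)" using i that[of "i - 2"] by simp
    have "S $$ (r, j - 1) * offset_coeff i j = (S *\<^sub>v a_vec n j) $ r / (real j + 1)"
      if "j \<in> {1..m}" for j
    proof -
      have "sqrt ((real j + 1) / real j) / (real j + 1) = 1 / sqrt (real j * (real j + 1))"
        unfolding sqrt_Suc_div by simp
      then have "S $$ (r, j - 1) * offset_coeff i j =
          S $$ (r, j - 1) * (sqrt ((real j + 1) / real j) / (real j + 1))"
        using that m by (simp only: offset_coeff_def) simp
      then show ?thesis using that i m mult_a_vec_index[OF S _ r, of j]
        by (simp add: mult.commute)
    qed
    moreover have "S $$ (r, Suc m - 1) * offset_coeff i (Suc m) = (S *\<^sub>v a_vec n (i - 1)) $ r"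
      using i m mult_a_vec_index[OF S _ r, of "Suc m"] by (simp add: offset_coeff_def)
    ultimately show ?thesis using m by simp
  qed
  finally show ?thesis .
qed

lemma dim_mean_base: "dim_vec (mean_base n S) = n"
proof -
  have "A_mat n \<in> carrier_mat n n" by (simp add: A_mat_def)
  then have "the (mat_inverse (A_mat n)) \<in> carrier_mat n n"
    by (rule mat_inverse_det_nonzero(3)[OF _ det_A_mat_nonzero])
  then show ?thesis by (auto simp: mean_base_def)
qed

lemma mu_eq:
  assumes S: "S \<in> carrier_mat n n" and i: "1 \<le> i" "i \<le> n + 1"
  shows "mu n S i = mean_base n S - S *\<^sub>v offset n i"
proof (rule eq_vecI)
  have car: "(\<lambda>j. (1 / (real j + 1)) \<cdot>\<^sub>v (S *\<^sub>v a_vec n j)) \<in> {1..i - 2} \<rightarrow> carrier_vec n"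
    using S by (auto simp: a_vec_def)
  note fcar = finsum_vec_closed[OF car]
  show "dim_vec (mu n S i) = dim_vec (mean_base n S - S *\<^sub>v offset n i)"
    using fcar S by (simp add: mu_def)
  fix r assume "r < dim_vec (mean_base n S - S *\<^sub>v offset n i)"
  then have r: "r < n" using S by simp
  have "finsum_vec TYPE(real) n (\<lambda>j. (1 / (real j + 1)) \<cdot>\<^sub>v (S *\<^sub>v a_vec n j)) {1..i - 2} $ r =
      (\<Sum>j = 1..i - 2. (S *\<^sub>v a_vec n j) $ r / (real j + 1))"
    by (subst index_finsum_vec[OF _ r car]) (use S r in \<open>auto simp: a_vec_def intro!: sum.cong\<close>)
  then show "mu n S i $ r = (mean_base n S - S *\<^sub>v offset n i) $ r"
    using r S fcar mult_offset_index[OF S i r] by (simp add: mu_def mean_base_def)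
qed

subsection \<open>The linear system for the common part of the means\<close>

text \<open>Each summand is the difference of the averages of the first \<open>c + 1\<close> and the
  first \<open>c\<close> values of \<open>q\<close>.\<close>

lemma telescoping_average:
  fixes q :: "nat \<Rightarrow> real"
  shows "(\<Sum>c = 1..<Suc r. (real c * q (c + 1) - (\<Sum>j = 1..c. q j)) / (real c * (real c + 1))) =
    (\<Sum>j = 1..Suc r. q j) / real (Suc r) - q 1"
proof (induction r)
  case 0
  then show ?case by simp
next
  case (Suc r)
  define Q where "Q = (\<Sum>j = 1..Suc r. q j)"
  have "(real (Suc r) * q (Suc r + 1) - Q) / (real (Suc r) * (real (Suc r) + 1)) =
      (Q + q (Suc (Suc r))) / real (Suc (Suc r)) - Q / real (Suc r)"
    by (simp add: field_simps)
  with Suc show ?case unfolding Q_def by simp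
qed

text \<open>Row \<open>r\<close> of the system solved by the common part of the means. The entries
  left of the diagonal telescope to the average of \<open>q 1, ..., q r\<close>; the diagonal entry
  gives \<open>q (r + 1)\<close> minus that same average.\<close>

lemma alpha_system:
  fixes q :: "nat \<Rightarrow> real"
  assumes "r \<ge> 1" "q 1 = 0"
  shows "(\<Sum>c = 1..r. alpha r c *
      ((real c * q (c + 1) - (\<Sum>j = 1..c. q j)) / (2 * sqrt (real c * (real c + 1))))) = q (r + 1)"
proof -
  define e where "e c = (real c * q (c + 1) - (\<Sum>j = 1..c. q j))" for c
  obtain m where m: "r = Suc m" using assms(1) by (cases r) auto
  have sq: "sqrt (real c * (real c + 1)) * sqrt (real c * (real c + 1)) = real c * (real c + 1)" for c
    by simp
  have "(\<Sum>c = 1..<r. alpha r c * (e c / (2 * sqrt (real c * (real c + 1))))) =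
      (\<Sum>c = 1..<r. e c / (real c * (real c + 1)))"
  proof (rule sum.cong[OF refl])
    fix c assume "c \<in> {1..<r}"
    then have "alpha r c * (e c / (2 * sqrt (real c * (real c + 1)))) =
      e c / (sqrt (real c * (real c + 1)) * sqrt (real c * (real c + 1)))"
      by (simp add: alpha_def)
    then show "alpha r c * (e c / (2 * sqrt (real c * (real c + 1)))) = e c / (real c * (real c + 1))"
      unfolding sq .
  qed
  \<comment> \<open>The boundary term of the telescoping sum is \<open>q 1 = 0\<close>.\<close>
  also have "\<dots> = (\<Sum>j = 1..r. q j) / real r"
    unfolding e_def m telescoping_average using assms(2) by simp
  finally have A: "(\<Sum>c = 1..<r. alpha r c * (e c / (2 * sqrt (real c * (real c + 1))))) =
      (\<Sum>j = 1..r. q j) / real r" .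
  have "alpha r r * (e r / (2 * sqrt (real r * (real r + 1)))) =
      (real r + 1) * e r / (sqrt (real r * (real r + 1)) * sqrt (real r * (real r + 1)))"
  proof -
    have *: "2 * (a / s) * (b / (2 * s)) = a * b / (s * s)" for a b s :: real by simp
    then show ?thesis by (simp only: * alpha_def sqrt_Suc_div if_True refl)
  qed
  also have "\<dots> = e r / real r" unfolding sq unfolding mult.commute[of "real r" "real r + 1"]
    by (rule mult_divide_mult_cancel_left) simp
  finally have B: "alpha r r * (e r / (2 * sqrt (real r * (real r + 1)))) = e r / real r" .
  have "{1..r} = insert r {1..<r}" using assms(1) by auto
  then have "(\<Sum>c = 1..r. alpha r c * (e c / (2 * sqrt (real c * (real c + 1))))) =
      e r / real r + (\<Sum>j = 1..r. q j) / real r"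
    using A B by simp
  also have "\<dots> = q (r + 1)" using assms(1) by (simp add: e_def field_simps)
  finally show ?thesis unfolding e_def .
qed

section \<open>The vector B vec(Sigma) as a list of quadratic forms\<close>

lemma offset_form_eq_sum:
  assumes "S \<in> carrier_mat n n"
  shows "offset_form n S i =
    (\<Sum>b = 1..n. \<Sum>j = 1..n. offset_coeff i b * offset_coeff i j * S $$ (j - 1, b - 1))"
proof -
  have "offset_form n S i =
    (\<Sum>j = 0..<n. \<Sum>b = 0..<n. offset_coeff i (Suc b) * offset_coeff i (Suc j) * S $$ (j, b))"
    using assms by (simp add: offset_form_def offset_def scalar_prod_def mult_mat_vec_def sum_distrib_left mult_ac)
  \<comment> \<open>The column index becomes the outer one, as in column stacking, where
    \<open>b\<close> numbers the blocks of \<open>B_mat\<close>.\<close>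
  also have "\<dots> = (\<Sum>b = 0..<n. \<Sum>j = 0..<n. offset_coeff i (Suc b) * offset_coeff i (Suc j) * S $$ (j, b))"
    by (rule sum.swap)
  also have "\<dots> = (\<Sum>b = 1..n. \<Sum>j = 1..n. offset_coeff i b * offset_coeff i j * S $$ (j - 1, b - 1))"
    by (simp add: sum.atLeast1_atMost_eq atLeast0LessThan)
  finally show ?thesis .
qed

text \<open>\<open>B\<close> carries each mixed coefficient of the quadratic form once, doubled, so its entries
  match the form only after symmetrization in \<open>b\<close> and \<open>j\<close>.\<close>

lemma beta_symmetrized:
  assumes "b \<ge> 1" "j \<ge> 1" "r \<ge> 1"
  shows "beta b r j + beta j r b = 2 * (offset_coeff (r + 1) b * offset_coeff (r + 1) j)"
proof -
  have diag: "(real r + 1) / real r = sqrt ((real r + 1) / real r) * sqrt ((real r + 1) / real r)"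
    by simp
  have mixed: "sqrt ((real r + 1) / (real r * real c * (real c + 1))) =
      sqrt ((real r + 1) / real r) * (1 / sqrt (real c * (real c + 1)))" for c
    by (simp add: real_sqrt_divide real_sqrt_mult)
  have lower: "1 / sqrt (real c * real c' * (real c + 1) * (real c' + 1)) =
      1 / sqrt (real c * (real c + 1)) * (1 / sqrt (real c' * (real c' + 1)))" for c c'
    by (simp add: real_sqrt_mult)
  \<comment> \<open>In the second and third cases one of the two entries is zero and the other holds
    the whole doubled coefficient; in the remaining cases the entries are equal.\<close>
  consider "b = r" "j = r" | "b < r" "j = r" | "b = r" "j < r" | "b < r" "j < r" | "r < b \<or> r < j"
    by linarith
  then show ?thesis
  proof cases
    case 1
    then show ?thesis using diag by (simp add: beta_def offset_coeff_def)
  next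
    case 2
    then show ?thesis using mixed[of b] by (simp add: beta_def offset_coeff_def)
  next
    case 3
    then show ?thesis using mixed[of j] by (simp add: beta_def offset_coeff_def)
  next
    case 4
    then have "beta b r j = offset_coeff (r + 1) b * offset_coeff (r + 1) j"
      "beta j r b = offset_coeff (r + 1) b * offset_coeff (r + 1) j"
      using lower[of j b] lower[of b j] by (simp_all add: beta_def offset_coeff_def mult.commute)
    then show ?thesis by simp
  next
    case 5
    then show ?thesis using assms by (auto simp: beta_def offset_coeff_def)
  qed
qed

text \<open>As \<open>S\<close> is symmetric, adding the double sum to itself with \<open>b\<close>
  and \<open>j\<close> exchanged symmetrizes the entries of \<open>B_mat\<close>. Position
  \<open>r\<close> has mathematical index \<open>r + 1\<close> and so belongs to class
  \<open>r + 2\<close>.\<close>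

lemma B_mat_vectorize_index:
  assumes S: "S \<in> carrier_mat n n" and sym: "transpose_mat S = S" and r: "r < n"
  shows "(B_mat n *\<^sub>v vectorize S) $ r = offset_form n S (r + 2)"
proof -
  have n: "n > 0" using r by simp
  define F where "F b j = beta b (r + 1) j * S $$ (j - 1, b - 1)" for b j
  have S_sym: "S $$ (j - 1, b - 1) = S $$ (b - 1, j - 1)" if "b \<in> {1..n}" "j \<in> {1..n}" for b j
    using that S arg_cong[OF sym, of "\<lambda>M. M $$ (j - 1, b - 1)"] by fastforce
  have bound: "b * n + j < n * n" if "b < n" "j < n" for b j
  proof -
    have "b * n + j < Suc b * n" using that by simp
    also have "\<dots> \<le> n * n" using that by (intro mult_right_mono) auto
    finally show ?thesis .
  qed
  have "(B_mat n *\<^sub>v vectorize S) $ r =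
    (\<Sum>c = 0..<n * n. beta (c div n + 1) (r + 1) (c mod n + 1) * S $$ (c mod n, c div n))"
    using S r by (simp add: B_mat_def vectorize_def mult_mat_vec_def scalar_prod_def)
  \<comment> \<open>Division with remainder by \<open>n\<close> splits a column number into its
    block and its position in the block.\<close>
  also have "\<dots> = (\<Sum>(b, j) \<in> {0..<n} \<times> {0..<n}. F (Suc b) (Suc j))"
    by (rule sum.reindex_bij_witness[of _ "\<lambda>(b, j). b * n + j" "\<lambda>c. (c div n, c mod n)"])
      (use n in \<open>auto simp: F_def less_mult_imp_div_less intro: bound\<close>)
  also have "\<dots> = (\<Sum>b = 1..n. \<Sum>j = 1..n. F b j)"
    by (simp add: sum.cartesian_product[symmetric] sum.atLeast1_atMost_eq atLeast0LessThan)
  finally have 1: "(B_mat n *\<^sub>v vectorize S) $ r = (\<Sum>b = 1..n. \<Sum>j = 1..n. F b j)" .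
  then have "2 * (B_mat n *\<^sub>v vectorize S) $ r =
      (\<Sum>b = 1..n. \<Sum>j = 1..n. F b j) + (\<Sum>b = 1..n. \<Sum>j = 1..n. F j b)"
    using sum.swap[of F "{1..n}" "{1..n}"] by simp
  also have "\<dots> = (\<Sum>b = 1..n. \<Sum>j = 1..n. F b j + F j b)"
    by (simp add: sum.distrib)
  also have "\<dots> = (\<Sum>b = 1..n. \<Sum>j = 1..n.
      2 * (offset_coeff (r + 2) b * offset_coeff (r + 2) j * S $$ (j - 1, b - 1)))"
  proof (intro sum.cong refl)
    fix b j assume bj: "b \<in> {1..n}" "j \<in> {1..n}"
    have "F b j + F j b = (beta b (r + 1) j + beta j (r + 1) b) * S $$ (j - 1, b - 1)"
      unfolding F_def S_sym[OF bj] by (simp add: algebra_simps)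
    then show "F b j + F j b =
        2 * (offset_coeff (r + 2) b * offset_coeff (r + 2) j * S $$ (j - 1, b - 1))"
      using beta_symmetrized[of b j "r + 1"] bj by simp
  qed
  also have "\<dots> = 2 * offset_form n S (r + 2)"
    unfolding offset_form_eq_sum[OF S] by (simp add: sum_distrib_left)
  finally show ?thesis by simp
qed

text \<open>The right-hand sides form a vector that \<open>A_mat n\<close> maps to
  \<open>B_mat n *\<^sub>v vectorize S\<close>; invertibility of \<open>A_mat n\<close> identifies
  it with \<open>mean_base n S\<close>.\<close>

lemma mean_base_index:
  assumes S: "S \<in> carrier_mat n n" and sym: "transpose_mat S = S" and r: "r < n"
  shows "mean_base n S $ r =
    (real (r + 1) * offset_form n S (r + 2) - (\<Sum>j = 1..r + 1. offset_form n S j)) /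
      (2 * sqrt (real (r + 1) * (real (r + 1) + 1)))"
proof -
  define q where "q = offset_form n S"
  define W where "W c = (real c * q (c + 1) - (\<Sum>j = 1..c. q j)) / (2 * sqrt (real c * (real c + 1)))" for c
  define w where "w = Matrix.vec n (\<lambda>k. W (k + 1))"
  have A: "A_mat n \<in> carrier_mat n n" by (simp add: A_mat_def)
  have w: "w \<in> carrier_vec n" by (simp add: w_def)
  \<comment> \<open>The first offset is zero: \<open>Suc k = 1\<close> holds only for
    \<open>k = 0\<close>, outside the range of coordinates.\<close>
  have q1: "q 1 = 0"
    using S by (simp add: q_def offset_form_eq_sum offset_coeff_def)
  have "A_mat n *\<^sub>v w = B_mat n *\<^sub>v vectorize S"
  proof (rule eq_vecI)
    show "dim_vec (A_mat n *\<^sub>v w) = dim_vec (B_mat n *\<^sub>v vectorize S)"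
      by (simp add: A_mat_def B_mat_def)
    fix i assume "i < dim_vec (B_mat n *\<^sub>v vectorize S)"
    then have i: "i < n" by (simp add: B_mat_def)
    have "(A_mat n *\<^sub>v w) $ i = (\<Sum>c = 0..<n. alpha (i + 1) (c + 1) * W (c + 1))"
      using i by (simp add: A_mat_def w_def mult_mat_vec_def scalar_prod_def)
    also have "\<dots> = (\<Sum>c = 1..n. alpha (i + 1) c * W c)"
      by (simp add: sum.atLeast1_atMost_eq atLeast0LessThan)
    \<comment> \<open>The matrix is lower triangular.\<close>
    also have "\<dots> = (\<Sum>c = 1..i + 1. alpha (i + 1) c * W c)"
      using i by (intro sum.mono_neutral_right) (auto simp: alpha_def)
    also have "\<dots> = q (i + 2)"
      unfolding W_def using alpha_system[of "i + 1" q, OF _ q1] by simp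
    finally show "(A_mat n *\<^sub>v w) $ i = (B_mat n *\<^sub>v vectorize S) $ i"
      using B_mat_vectorize_index[OF S sym i] by (simp add: q_def)
  qed
  then have "mean_base n S = w"
    unfolding mean_base_def using mat_inverse_mult_vec_eqI[OF A det_A_mat_nonzero w] by simp
  then show ?thesis using r by (simp add: w_def W_def q_def)
qed

subsection \<open>Latent densities\<close>

lemma class_cov_carrier:
  assumes "S \<in> carrier_mat n n" "n \<le> d"
  shows "class_cov n d S \<in> carrier_mat d d"
  using assms four_block_carrier_mat[OF assms(1), of "1\<^sub>m (d - n)" "d - n" "d - n"]
  by (simp add: class_cov_def)

lemma transpose_class_cov:
  assumes S: "S \<in> carrier_mat n n" and sym: "transpose_mat S = S"
  shows "transpose_mat (class_cov n d S) = class_cov n d S"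
  unfolding class_cov_def
  by (subst transpose_four_block_mat[OF S]) (auto simp: sym)

lemma det_class_cov:
  assumes "S \<in> carrier_mat n n"
  shows "Determinant.det (class_cov n d S) = Determinant.det S"
  unfolding class_cov_def
  by (subst det_four_block_mat_upper_right_zero[OF assms refl]) auto

lemma class_cov_mult_append_zero:
  assumes S: "S \<in> carrier_mat n n" and v: "v \<in> carrier_vec n"
  shows "class_cov n d S *\<^sub>v (v @\<^sub>v 0\<^sub>v (d - n)) = S *\<^sub>v v @\<^sub>v 0\<^sub>v (d - n)"
  unfolding class_cov_def
  by (subst four_block_mat_mult_vec[OF S _ _ _ v]) (use S v in auto)

lemma scalar_prod_append_zero:
  fixes y :: "'a::comm_semiring_0 Matrix.vec"
  assumes y: "y \<in> carrier_vec d" and v: "v \<in> carrier_vec n" and "n \<le> d"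
  shows "scalar_prod y (v @\<^sub>v 0\<^sub>v (d - n)) = scalar_prod (vec_first y n) v"
proof -
  have "y = vec_first y n @\<^sub>v vec_last y (d - n)"
    using y assms(3) by simp
  then have "scalar_prod y (v @\<^sub>v 0\<^sub>v (d - n)) =
      scalar_prod (vec_first y n @\<^sub>v vec_last y (d - n)) (v @\<^sub>v 0\<^sub>v (d - n))"
    by simp
  also have "\<dots> = scalar_prod (vec_first y n) v + scalar_prod (vec_last y (d - n)) (0\<^sub>v (d - n))"
    by (rule scalar_prod_append[of _ n _ "d - n"]) (use v in auto)
  finally show ?thesis by simp
qed

text \<open>The deviation from the mean of class \<open>i\<close> is a common vector plus the
  covariance applied to the zero-padded offset, so \<open>inverse_quadratic_form_shift\<close>
  applies. The factor \<open>c\<close> may depend on \<open>z\<close> but not on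
  \<open>i\<close>.\<close>

lemma mvn_density_class:
  assumes pd: "pos_def_mat n S" and nd: "n \<le> d" and z: "z \<in> carrier_vec d"
  obtains c where "c \<noteq> 0"
    "\<And>i. 1 \<le> i \<Longrightarrow> i \<le> n + 1 \<Longrightarrow> mvn_density (class_mean n d S i) (class_cov n d S) z =
      c * exp (- scalar_prod (vec_first z n - mean_base n S) (offset n i) - offset_form n S i / 2)"
proof -
  have S: "S \<in> carrier_mat n n" and sym: "transpose_mat S = S"
    using pd by (auto simp: pos_def_mat_def)
  define K where "K = class_cov n d S"
  have K: "K \<in> carrier_mat d d" and Ksym: "transpose_mat K = K" and Kdet: "Determinant.det K \<noteq> 0"
    using class_cov_carrier[OF S nd] transpose_class_cov[OF S sym] det_class_cov[OF S]
      pos_def_mat_det_nonzero[OF pd] by (auto simp: K_def)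
  define v where "v = z - (mean_base n S @\<^sub>v 0\<^sub>v (d - n))"
  have v: "v \<in> carrier_vec d"
    using nd by (intro carrier_vecI) (simp add: v_def dim_mean_base)
  have v_first: "vec_first v n = vec_first z n - mean_base n S"
    using z nd by (intro eq_vecI) (auto simp: v_def vec_first_def dim_mean_base)
  \<comment> \<open>Collects the normalizing constant and the part of the exponent quadratic in
    \<open>z\<close>.\<close>
  define c where "c = exp (- scalar_prod v (the (mat_inverse K) *\<^sub>v v) / 2) /
    sqrt ((2 * pi) ^ d * Determinant.det K)"
  show thesis
  proof (rule that)
    show "c \<noteq> 0" using Kdet by (simp add: c_def)
    fix i assume i: "1 \<le> i" "i \<le> n + 1"
    define u where "u = offset n i @\<^sub>v 0\<^sub>v (d - n)"
    have u: "u \<in> carrier_vec d"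
      using append_carrier_vec[OF offset_carrier zero_carrier_vec, of n i "d - n"] nd
      by (simp add: u_def)
    have Ku: "K *\<^sub>v u = S *\<^sub>v offset n i @\<^sub>v 0\<^sub>v (d - n)"
      unfolding K_def u_def by (rule class_cov_mult_append_zero[OF S offset_carrier])
    have mean: "class_mean n d S i = (mean_base n S - S *\<^sub>v offset n i) @\<^sub>v 0\<^sub>v (d - n)"
      by (simp add: class_mean_def mu_eq[OF S i])
    have diff: "z - class_mean n d S i = v + K *\<^sub>v u"
      unfolding mean Ku v_def using z nd S
      by (intro eq_vecI) (auto simp: dim_mean_base)
    have vu: "scalar_prod v u = scalar_prod (vec_first z n - mean_base n S) (offset n i)"
      unfolding u_def v_first[symmetric] by (rule scalar_prod_append_zero[OF v offset_carrier nd])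
    have uKu: "scalar_prod u (K *\<^sub>v u) = offset_form n S i"
    proof -
      have "vec_first u n = offset n i"
        by (intro eq_vecI) (auto simp: u_def vec_first_def offset_def)
      then show ?thesis
        unfolding Ku offset_form_def using scalar_prod_append_zero[OF u _ nd, of "S *\<^sub>v offset n i"] S by simp
    qed
    have dim: "dim_vec (class_mean n d S i) = d"
      using nd S by (simp add: mean)
    show "mvn_density (class_mean n d S i) (class_cov n d S) z =
      c * exp (- scalar_prod (vec_first z n - mean_base n S) (offset n i) - offset_form n S i / 2)"
      unfolding mvn_density_def K_def[symmetric] diff dim
        inverse_quadratic_form_shift[OF K Ksym Kdet v u] vu uKu c_def
      by (simp add: exp_add[symmetric] field_simps)
  qed
qed

section \<open>The isometric-log-ratio transform of densities with log-linear ratios\<close>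

lemma ilr_component_common_factor:
  fixes L :: "nat \<Rightarrow> real"
  assumes "c \<noteq> 0"
  shows "ln ((\<Prod>j = 1..i. c * exp (L j)) / (c * exp (L (i + 1))) ^ i) =
    (\<Sum>j = 1..i. L j) - real i * L (i + 1)"
proof -
  \<comment> \<open>Numerator and denominator both contain the factor \<open>c ^ i\<close>.\<close>
  have "(\<Prod>j = 1..i. c * exp (L j)) / (c * exp (L (i + 1))) ^ i =
      exp (\<Sum>j = 1..i. L j) / exp (real i * L (i + 1))"
    using assms by (simp add: prod.distrib exp_sum power_mult_distrib exp_of_nat_mult)
  then show ?thesis by (simp add: exp_diff[symmetric])
qed

text \<open>Before division by \<open>\<rho>\<close>, the linear part of a component is
  \<open>\<rho>\<close> times the coordinate of \<open>y - mean_base n S\<close>, and the quadratic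
  forms give back exactly \<open>\<rho>\<close> times that of \<open>mean_base n S\<close>.\<close>

lemma ilr_log_linear:
  assumes S: "S \<in> carrier_mat n n" and sym: "transpose_mat S = S"
    and c: "c \<noteq> 0" and y: "y \<in> carrier_vec n"
    and p: "\<And>i. 1 \<le> i \<Longrightarrow> i \<le> n + 1 \<Longrightarrow> p i =
      c * exp (- scalar_prod (y - mean_base n S) (offset n i) - offset_form n S i / 2)"
  shows "ilr (Matrix.vec (n + 1) (\<lambda>k. p (k + 1))) = y"
proof (rule eq_vecI)
  show "dim_vec (ilr (Matrix.vec (n + 1) (\<lambda>k. p (k + 1)))) = dim_vec y"
    using y by (simp add: ilr_def)
  fix r assume "r < dim_vec y"
  then have r: "r < n" using y by simp
  define q where "q = offset_form n S"
  define v where "v = y - mean_base n S"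
  define L where "L i = - scalar_prod v (offset n i) - q i / 2" for i
  define i where "i = r + 1"
  define \<rho> where "\<rho> = sqrt (real i * (real i + 1))"
  have \<rho>: "\<rho> > 0" by (simp add: \<rho>_def i_def)
  have "(\<Sum>j = 1..i. scalar_prod v (offset n j)) - real i * scalar_prod v (offset n (i + 1)) =
      (\<Sum>k = 0..<n. v $ k *
        ((\<Sum>j = 1..i. offset_coeff j (k + 1)) - real i * offset_coeff (i + 1) (k + 1)))"
  proof -
    have "(\<Sum>j = 1..i. scalar_prod v (offset n j)) =
        (\<Sum>k = 0..<n. \<Sum>j = 1..i. v $ k * offset_coeff j (k + 1))"
      by (simp add: scalar_prod_def offset_def sum.swap[of _ "{0..<n}"])
    then show ?thesis
      by (simp add: scalar_prod_def offset_def sum_distrib_left sum_subtractf right_diff_distrib mult_ac)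
  qed
  also have "\<dots> = (\<Sum>k = 0..<n. if k = r then - (\<rho> * v $ r) else 0)"
    by (intro sum.cong refl, subst sum_offset_coeff_diff) (simp_all add: \<rho>_def i_def)
  also have "\<dots> = - (\<rho> * v $ r)" using r by simp
  finally have lin: "(\<Sum>j = 1..i. scalar_prod v (offset n j)) - real i * scalar_prod v (offset n (i + 1)) =
      - (\<rho> * v $ r)" .
  have "(\<Sum>j = 1..i. L j) - real i * L (i + 1) =
      - ((\<Sum>j = 1..i. scalar_prod v (offset n j)) - real i * scalar_prod v (offset n (i + 1)))
      + (real i * q (i + 1) - (\<Sum>j = 1..i. q j)) / 2"
    by (simp add: L_def sum_subtractf sum_negf sum_divide_distrib algebra_simps diff_divide_distrib)
  also have "(real i * q (i + 1) - (\<Sum>j = 1..i. q j)) / 2 = \<rho> * mean_base n S $ r"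
    using \<rho> mean_base_index[OF S sym r] by (simp add: q_def \<rho>_def i_def)
  finally have sumL: "(\<Sum>j = 1..i. L j) - real i * L (i + 1) = \<rho> * y $ r"
    unfolding lin using r y by (simp add: v_def dim_mean_base algebra_simps)
  have pL: "p j = c * exp (L j)" if "1 \<le> j" "j \<le> n + 1" for j
    using p[OF that] by (simp add: L_def v_def q_def)
  have "ilr (Matrix.vec (n + 1) (\<lambda>k. p (k + 1))) $ r = 1 / \<rho> * ln ((\<Prod>j = 1..i. p j) / p (i + 1) ^ i)"
  proof -
    have "(\<Prod>j = 1..i. Matrix.vec (n + 1) (\<lambda>k. p (k + 1)) $ (j - 1)) = (\<Prod>j = 1..i. p j)"
      using r by (intro prod.cong refl) (auto simp: i_def)
    then show ?thesis
      unfolding \<open>_ = (\<Prod>j = 1..i. p j)\<close>[symmetric]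
      using r by (simp add: ilr_def Let_def \<rho>_def i_def)
  qed
  also have "(\<Prod>j = 1..i. p j) / p (i + 1) ^ i = (\<Prod>j = 1..i. c * exp (L j)) / (c * exp (L (i + 1))) ^ i"
    using r by (simp add: pL i_def)
  also have "1 / \<rho> * ln \<dots> = y $ r"
    unfolding ilr_component_common_factor[OF c] sumL using \<rho> by simp
  finally show "ilr (Matrix.vec (n + 1) (\<lambda>k. p (k + 1))) $ r = y $ r" .
qed

subsection \<open>The Jacobian of the diffeomorphism\<close>

text \<open>By the chain rule the derivative of the inverse map is a left inverse of that of
  \<open>g\<close>, which is therefore injective.\<close>

lemma diffeomorphism_det_nonzero:
  fixes g :: "real ^ 'd::finite \<Rightarrow> real ^ 'd"
  assumes dif: "diffeomorphism Z X g" and Z: "open Z" and z: "z \<in> Z"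
  shows "Determinants.det (matrix (frechet_derivative g (at z))) \<noteq> 0"
proof -
  have bij: "bij_betw g Z X" using dif by (simp add: diffeomorphism_def)
  then have gz: "g z \<in> X" using z by (auto simp: bij_betw_def)
  obtain g' where g': "(g has_derivative g') (at z)"
    using dif z unfolding diffeomorphism_def C1_on_def by blast
  obtain h' where h': "(inv_into Z g has_derivative h') (at (g z))"
    using dif gz unfolding diffeomorphism_def C1_on_def by blast
  have "((\<lambda>x. inv_into Z g (g x)) has_derivative (\<lambda>x. h' (g' x))) (at z)"
    using has_derivative_compose[OF g' h'] .
  \<comment> \<open>The composition is the identity on \<open>Z\<close>; as \<open>Z\<close> is
    open, this determines the derivative at \<open>z\<close>.\<close>
  moreover have "((\<lambda>x. inv_into Z g (g x)) has_derivative (\<lambda>x. x)) (at z)"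
    by (rule has_derivative_transform_within_open[OF has_derivative_ident Z z])
      (use bij in \<open>auto simp: bij_betw_def inv_into_f_f\<close>)
  ultimately have "(\<lambda>x. h' (g' x)) = (\<lambda>x. x)"
    by (rule has_derivative_unique)
  then have "inj g'" by (metis injI)
  then show ?thesis
    using det_nz_iff_inj[OF has_derivative_linear[OF g']] frechet_derivative_at[OF g'] by simp
qed

theorem theorem6:
  fixes D d :: nat
    and S :: "real Matrix.mat"
    and ix :: "nat \<Rightarrow> 'd::finite"
    and XX ZZ :: "(real ^ 'd) set"
    and g :: "real ^ 'd \<Rightarrow> real ^ 'd"
    and M :: "'w measure"
    and C :: "nat \<Rightarrow> 'w set"
    and x :: "'w \<Rightarrow> real ^ 'd"
  assumes "D \<ge> 2" and "d \<ge> D - 1"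
    and "CARD('d) = d" and "bij_betw ix {..<d} UNIV"
    and "pos_def_mat (D - 1) S"
    and "open XX" and "open ZZ" and "diffeomorphism ZZ XX g"
    and "prob_space M"
    and "\<And>i. i \<in> {1..D} \<Longrightarrow> C i \<in> sets M \<and> measure M (C i) > 0"
    and "x \<in> borel_measurable M" and "\<And>w. w \<in> space M \<Longrightarrow> x w \<in> XX"
    and "\<And>i. i \<in> {1..D} \<Longrightarrow>
      distributed (uniform_measure M (C i)) lborel (\<lambda>w. inv_into ZZ g (x w))
        (\<lambda>z. ennreal (latent_density ix (D - 1) S i z))"
  shows "\<forall>y\<in>XX. vec_first (coords ix (inv_into ZZ g y)) (D - 1) =
    ilr (Matrix.vec D (\<lambda>k. class_density ix ZZ g (D - 1) S (k + 1) y))"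
proof
  fix y assume y: "y \<in> XX"
  define n where "n = D - 1"
  have D: "D = n + 1" using assms(1) by (simp add: n_def)
  have nd: "n \<le> CARD('d)" using assms(2,3) by (simp add: n_def)
  have pd: "pos_def_mat n S" using assms(5) by (simp add: n_def)
  then have S: "S \<in> carrier_mat n n" "transpose_mat S = S" by (auto simp: pos_def_mat_def)
  define z where "z = inv_into ZZ g y"
  have "z \<in> ZZ"
    using assms(8) y by (auto simp: z_def diffeomorphism_def bij_betw_def intro: inv_into_into)
  then have J: "Determinants.det (matrix (frechet_derivative g (at z))) \<noteq> 0"
    by (rule diffeomorphism_det_nonzero[OF assms(8) assms(7)])
  have cz: "coords ix z \<in> carrier_vec CARD('d)" by (simp add: coords_def)
  obtain c where c: "c \<noteq> 0"
    "\<And>i. 1 \<le> i \<Longrightarrow> i \<le> n + 1 \<Longrightarrow> latent_density ix n S i z = c *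
      exp (- scalar_prod (vec_first (coords ix z) n - mean_base n S) (offset n i) - offset_form n S i / 2)"
    using mvn_density_class[OF pd nd cz] unfolding latent_density_def by metis
  have "ilr (Matrix.vec (n + 1) (\<lambda>k. class_density ix ZZ g n S (k + 1) y)) = vec_first (coords ix z) n"
  proof (rule ilr_log_linear[OF S])
    show "c * inverse \<bar>Determinants.det (matrix (frechet_derivative g (at z)))\<bar> \<noteq> 0"
      using c(1) J by simp
    show "vec_first (coords ix z) n \<in> carrier_vec n" by simp
  qed (simp add: class_density_def change_of_variable_density_def Let_def c(2) flip: z_def)
  then show "vec_first (coords ix (inv_into ZZ g y)) (D - 1) =
      ilr (Matrix.vec D (\<lambda>k. class_density ix ZZ g (D - 1) S (k + 1) y))"
    unfolding D by (simp add: z_def)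
qed

end
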